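(* Let $k\ge4$, and let $\sigma,\tau\in\mathcal S_k$ be given in one-line notation by $\sigma=1\,k\,\alpha\,(k-2)\,(k-1)$ and $\tau=1\,(k-1)\,\beta\,(k-2)\,k$, where $\alpha$ and $\beta$ are arbitrary permutations (arrangements) of $\{2,3,\dots,k-3\}$ (empty when $k=4$). Then $\sigma\equiv\tau$.
   Context: $\mathcal S_k$ is the set of permutations of $\{1,\dots,k\}$. For a sequence of distinct reals, $\mathrm{st}$ replaces the smallest entry by $1$, the second smallest by $2$, etc. Let $X_1,X_2,\dots$ be i.i.d. continuous random variables (e.g. uniform on $[0,1]$). A consecutive occurrence of $\sigma\in\mathcal S_k$ is a block $X_i,\dots,X_{i+k-1}$ with $\mathrm{st}(X_i\dots X_{i+k-1})=\sigma$. For distinct $\sigma,\tau\in\mathcal S_k$, $\Pr(\sigma\prec\tau)$ is the probability that the first consecutive occurrence of $\sigma$ appears before the first consecutive occurrence of $\tau$. We write $\sigma\equiv\tau$ if $\Pr(\sigma\prec\tau)=\Pr(\tau\prec\sigma)=\frac12$. *)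

theory Defs
  imports "HOL-Probability.Probability" "HOL-Combinatorics.Multiset_Permutations"
    "HOL-Library.Extended_Nat"
begin

text \<open>
  Permutations of \<open>{1..k}\<close> are written in one-line notation, as elements of
  \<open>permutations_of_set {1..k}\<close>. Random sequences are indexed from 0, so \<open>x 0\<close> is the first entry.
\<close>

definition st :: "real list \<Rightarrow> nat list" where
  "st xs = map (\<lambda>x. card {y \<in> set xs. y \<le> x}) xs"

definition occurs_at :: "nat list \<Rightarrow> (nat \<Rightarrow> real) \<Rightarrow> nat \<Rightarrow> bool" where
  "occurs_at \<sigma> x i \<longleftrightarrow>
     distinct (map x [i..<i + length \<sigma>]) \<and> st (map x [i..<i + length \<sigma>]) = \<sigma>"

text \<open>The value is \<open>\<infinity>\<close> if there is no occurrence.\<close>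

definition first_occurrence :: "nat list \<Rightarrow> (nat \<Rightarrow> real) \<Rightarrow> enat" where
  "first_occurrence \<sigma> x = (INF i\<in>{i. occurs_at \<sigma> x i}. enat i)"

definition prob_before ::
  "'a measure \<Rightarrow> (nat \<Rightarrow> 'a \<Rightarrow> real) \<Rightarrow> nat list \<Rightarrow> nat list \<Rightarrow> real" where
  "prob_before M X \<sigma> \<tau> = measure M
     {\<omega> \<in> space M. first_occurrence \<sigma> (\<lambda>i. X i \<omega>) < first_occurrence \<tau> (\<lambda>i. X i \<omega>)}"

definition pattern_equiv ::
  "'a measure \<Rightarrow> (nat \<Rightarrow> 'a \<Rightarrow> real) \<Rightarrow> nat list \<Rightarrow> nat list \<Rightarrow> bool" where
  "pattern_equiv M X \<sigma> \<tau> \<longleftrightarrow> prob_before M X \<sigma> \<tau> = 1 / 2 \<and> prob_before M X \<tau> \<sigma> = 1 / 2"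

text \<open>
  A random variable is called continuous if its distribution function is continuous (equivalently,
  its distribution has no atoms); a density is not required.
\<close>

definition iid_continuous :: "'a measure \<Rightarrow> (nat \<Rightarrow> 'a \<Rightarrow> real) \<Rightarrow> bool" where
  "iid_continuous M X \<longleftrightarrow>
     prob_space M \<and>
     prob_space.indep_vars M (\<lambda>_. borel) X UNIV \<and>
     (\<forall>i. distr M borel (X i) = distr M borel (X 0)) \<and>
     (\<forall>i. continuous_on UNIV (cdf (distr M borel (X i))))"

end

theory Submission
  imports Defs
begin

text \<open>
  Only the frame of the two patterns matters: their minimum comes first, their third largest value
  comes last but one, and their two largest values sit in the second and the last position. Blocks
  with such a frame overlap in at most two positions (\<open>frame_at_overlap\<close>).

  The law of the sequence is invariant under permutations of the indices, so probabilities can be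
  compared by rearranging the entries of a single block. Fix \<open>i\<close> and consider the event that \<open>\<sigma>\<close>
  occurs at \<open>i\<close> and neither \<open>\<sigma>\<close> nor \<open>\<tau>\<close> occurs earlier, and the same event with \<open>\<tau>\<close> at \<open>i\<close>. If \<open>\<tau>\<close>
  arises from \<open>\<sigma>\<close> by exchanging the two largest values, that is if \<open>\<alpha> = \<beta>\<close>, then exchanging the second
  and the last entry of the block at \<open>i\<close> maps one event onto the other. Indeed the overlap
  bound lets an earlier occurrence be affected only if it ends at the second entry of the block at
  \<open>i\<close>, and whether a block shows one of the two patterns does not depend on how large its last entry
  is, as long as this exceeds the entry before it (\<open>occurs_at_either_block_perm\<close>).

  In general let \<open>\<tau>'\<close> be \<open>\<sigma>\<close> with its two largest values exchanged. The patterns \<open>\<tau>\<close> and \<open>\<tau>'\<close> have the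
  same frame with the two largest values in the same order, and differ only in the arrangement of the
  interior. Replacing the forbidden \<open>\<tau>\<close> by \<open>\<tau>'\<close>, at one position after the other, leaves the
  probability unchanged, because the interior of a frame can be rearranged without affecting
  occurrences anywhere else (\<open>prob_first_block_replace_at\<close>). This reduces the general case to the
  previous argument.

  Summing over \<open>i\<close>, the events that \<open>\<sigma>\<close> comes first and that \<open>\<tau>\<close> comes first are equally likely.
  Almost surely some occurrence exists (\<open>AE_occurs_somewhere\<close>), so both probabilities are \<open>1 / 2\<close>.
\<close>

section \<open>Occurrences as order isomorphisms\<close>

lemma permutations_of_set_nth:
  assumes "\<pi> \<in> permutations_of_set {1..k}"
  shows "length \<pi> = k"
    and "a < k \<Longrightarrow> 1 \<le> \<pi> ! a \<and> \<pi> ! a \<le> k"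
    and "a < k \<Longrightarrow> b < k \<Longrightarrow> \<pi> ! a = \<pi> ! b \<longleftrightarrow> a = b"
proof -
  have set: "set \<pi> = {1..k}" and dist: "distinct \<pi>"
    using assms by (auto simp: permutations_of_set_def)
  show len: "length \<pi> = k"
    using distinct_card[OF dist] set by simp
  show "1 \<le> \<pi> ! a \<and> \<pi> ! a \<le> k" if "a < k"
    using nth_mem[of a \<pi>] that len set by simp
  show "\<pi> ! a = \<pi> ! b \<longleftrightarrow> a = b" if "a < k" "b < k"
    using nth_eq_iff_index_eq[OF dist] that len by simp
qed

lemma st_nth:
  "a < length xs \<Longrightarrow> st xs ! a = card {y \<in> set xs. y \<le> xs ! a}"
  by (simp add: st_def)

lemma st_nth_less_iff:
  assumes "a < length xs" "b < length xs"
  shows "st xs ! a < st xs ! b \<longleftrightarrow> xs ! a < xs ! b"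
proof
  assume "xs ! a < xs ! b"
  then have "{y \<in> set xs. y \<le> xs ! a} \<subseteq> {y \<in> set xs. y \<le> xs ! b}"
    and "xs ! b \<in> {y \<in> set xs. y \<le> xs ! b}" "xs ! b \<notin> {y \<in> set xs. y \<le> xs ! a}"
    using assms by auto
  then have "{y \<in> set xs. y \<le> xs ! a} \<subset> {y \<in> set xs. y \<le> xs ! b}" by blast
  then show "st xs ! a < st xs ! b"
    unfolding st_nth[OF assms(1)] st_nth[OF assms(2)] by (intro psubset_card_mono) auto
next
  assume "st xs ! a < st xs ! b"
  moreover have "st xs ! b \<le> st xs ! a" if "xs ! b \<le> xs ! a"
    unfolding st_nth[OF assms(1)] st_nth[OF assms(2)] using that by (intro card_mono) auto
  ultimately show "xs ! a < xs ! b" by linarith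
qed

text \<open>
  This is the only way in which occurrences are inspected below: standardization preserves and
  reflects strict order, and the value \<open>\<pi> ! a\<close> is recovered as the number of entries of \<open>\<pi>\<close> that are
  at most \<open>\<pi> ! a\<close>.
\<close>

lemma occurs_at_iff_order_iso:
  assumes \<pi>: "\<pi> \<in> permutations_of_set {1..k}"
  shows "occurs_at \<pi> x s \<longleftrightarrow> (\<forall>a<k. \<forall>b<k. \<pi> ! a < \<pi> ! b \<longleftrightarrow> x (s + a) < x (s + b))"
    (is "_ \<longleftrightarrow> ?iso")
proof -
  note nth = permutations_of_set_nth[OF \<pi>]
  let ?xs = "map x [s..<s + k]"
  have xs: "?xs ! a = x (s + a)" if "a < k" for a using that by simp
  show ?thesis
  proof
    assume "occurs_at \<pi> x s"
    then have "st ?xs = \<pi>" using nth(1) by (simp add: occurs_at_def)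
    then show ?iso using st_nth_less_iff[of _ ?xs] by auto
  next
    assume iso: ?iso
    have eq: "x (s + a) = x (s + b) \<longleftrightarrow> a = b" if "a < k" "b < k" for a b
      using iso that nth(3)[OF that] by (metis less_irrefl linorder_neq_iff)
    have dist: "distinct ?xs"
      using eq by (auto simp: distinct_conv_nth)
    have "st ?xs ! a = \<pi> ! a" if a: "a < k" for a
    proof -
      have "{y \<in> set ?xs. y \<le> x (s + a)} = (\<lambda>b. x (s + b)) ` {b. b < k \<and> \<pi> ! b \<le> \<pi> ! a}"
      proof -
        have "set ?xs = (\<lambda>b. x (s + b)) ` {..<k}"
        proof -
          have "?xs = map (\<lambda>b. x (s + b)) [0..<k]" by (intro nth_equalityI) auto
          then show ?thesis by (simp add: atLeast0LessThan)
        qed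
        moreover have "x (s + b) \<le> x (s + a) \<longleftrightarrow> \<pi> ! b \<le> \<pi> ! a" if "b < k" for b
          using iso a that by (metis linorder_not_less)
        ultimately show ?thesis by auto
      qed
      also have "card \<dots> = card {b. b < k \<and> \<pi> ! b \<le> \<pi> ! a}"
        using eq by (intro card_image) (auto simp: inj_on_def)
      also have "\<dots> = card ((!) \<pi> ` {b. b < k \<and> \<pi> ! b \<le> \<pi> ! a})"
        using nth(3) by (intro card_image[symmetric]) (auto simp: inj_on_def)
      also have "(!) \<pi> ` {b. b < k \<and> \<pi> ! b \<le> \<pi> ! a} = {1..\<pi> ! a}"
      proof -
        have "{1..k} = (!) \<pi> ` {..<k}"
          using \<pi> nth(1) by (auto simp: permutations_of_set_def set_conv_nth)
        then show ?thesis using nth(2)[OF a] by (fastforce simp: image_iff set_eq_iff)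
      qed
      finally show ?thesis using a by (simp add: st_nth)
    qed
    then have "st ?xs = \<pi>"
      using nth(1) by (intro nth_equalityI) (auto simp: st_def)
    then show "occurs_at \<pi> x s"
      using dist nth(1) by (simp add: occurs_at_def)
  qed
qed

lemma st_permutation:
  assumes "distinct xs"
  shows "st xs \<in> permutations_of_set {1..length xs}"
proof -
  have len: "length (st xs) = length xs" by (simp add: st_def)
  have "inj_on (\<lambda>x. st xs ! x) {..<length xs}"
    using st_nth_less_iff[of _ xs] assms
    by (auto simp: inj_on_def) (metis linorder_neq_iff nth_eq_iff_index_eq)
  then have dist: "distinct (st xs)"
    using len by (auto simp: distinct_conv_nth inj_on_def)
  have "set (st xs) \<subseteq> {1..length xs}"
  proof
    fix v assume "v \<in> set (st xs)"
    then obtain x where x: "x \<in> set xs" and v: "v = card {y \<in> set xs. y \<le> x}"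
      by (auto simp: st_def)
    have "v \<noteq> 0" using x v by auto
    moreover have "v \<le> card (set xs)" unfolding v by (intro card_mono) auto
    ultimately show "v \<in> {1..length xs}" using distinct_card[OF assms] by simp
  qed
  moreover have "card (set (st xs)) = length xs" using dist len distinct_card by fastforce
  ultimately have "set (st xs) = {1..length xs}" by (intro card_subset_eq) auto
  with dist show ?thesis by (simp add: permutations_of_set_def)
qed

section \<open>Rearranging a block\<close>

text \<open>
  A rearrangement of the \<open>k\<close> positions starting at \<open>s\<close>, as a permutation of all positions. Composing a
  sequence with it moves the entries of one block and leaves the rest of the sequence alone.
\<close>

definition block_perm :: "(nat \<Rightarrow> nat) \<Rightarrow> nat \<Rightarrow> nat \<Rightarrow> nat \<Rightarrow> nat" where
  "block_perm q k s n = (if n \<in> {s..<s + k} then s + q (n - s) else n)"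

lemma block_perm_inside: "a < k \<Longrightarrow> block_perm q k s (s + a) = s + q a"
  by (simp add: block_perm_def)

lemma bij_block_perm:
  assumes q: "q permutes {..<k}"
  shows "bij (block_perm q k s)"
proof -
  have q_less: "q a < k \<longleftrightarrow> a < k" for a
    using permutes_in_image[OF q, of a] by simp
  show ?thesis
  proof (rule bij_betw_byWitness[where f' = "block_perm (inv q) k s"])
    have inv_less: "inv q a < k \<longleftrightarrow> a < k" for a
      using permutes_in_image[OF permutes_inv[OF q], of a] by simp
    show "\<forall>a\<in>UNIV. block_perm (inv q) k s (block_perm q k s a) = a"
      using q_less permutes_inverses[OF q] by (auto simp: block_perm_def)
    show "\<forall>a\<in>UNIV. block_perm q k s (block_perm (inv q) k s a) = a"
      using inv_less permutes_inverses[OF q] by (auto simp: block_perm_def)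
  qed auto
qed

lemma inj_comp_block_perm_iff:
  assumes "q permutes {..<k}"
  shows "inj (x \<circ> block_perm q k s) \<longleftrightarrow> inj x"
  using bij_block_perm[OF assms, of s]
  by (metis bij_betw_imp_inj_on bij_betw_imp_surj_on inj_compose inj_on_imageI)

text \<open>
  Rearranging the entries of a block that shows \<open>\<pi>\<close> turns it into a block that shows the
  correspondingly rearranged word, and all occurrences of that word arise in this way.
\<close>

lemma occurs_at_block_perm:
  assumes \<pi>: "\<pi> \<in> permutations_of_set {1..k}" and q: "q permutes {..<k}"
  shows "occurs_at (permute_list q \<pi>) (x \<circ> block_perm q k s) s \<longleftrightarrow> occurs_at \<pi> x s"
proof -
  note nth = permutations_of_set_nth[OF \<pi>]
  have perm: "permute_list q \<pi> \<in> permutations_of_set {1..k}"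
    using \<pi> q nth(1) by (simp add: permutations_of_set_def)
  have q_less: "q a < k" if "a < k" for a
    using permutes_in_image[OF q, of a] that by simp
  have "occurs_at (permute_list q \<pi>) (x \<circ> block_perm q k s) s \<longleftrightarrow>
      (\<forall>a<k. \<forall>b<k. \<pi> ! q a < \<pi> ! q b \<longleftrightarrow> x (s + q a) < x (s + q b))"
    unfolding occurs_at_iff_order_iso[OF perm]
    using q nth(1) by (simp add: block_perm_inside permute_list_nth)
  also have "\<dots> \<longleftrightarrow> (\<forall>a<k. \<forall>b<k. \<pi> ! a < \<pi> ! b \<longleftrightarrow> x (s + a) < x (s + b))"
  proof -
    have "\<exists>c<k. a = q c" if "a < k" for a
      using permutes_image[OF q] that by (metis image_iff lessThan_iff)
    then show ?thesis using q_less by (metis (full_types))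
  qed
  finally show ?thesis unfolding occurs_at_iff_order_iso[OF \<pi>] .
qed

lemma exists_rearrangement:
  assumes "\<pi> \<in> permutations_of_set {1..k}" "\<pi>' \<in> permutations_of_set {1..k}"
  obtains q where "q permutes {..<k}" "permute_list q \<pi> = \<pi>'"
proof -
  have "mset \<pi>' = mset \<pi>"
    using assms by (auto simp: permutations_of_set_def intro: set_eq_iff_mset_eq_distinct[THEN iffD1])
  then obtain q where "q permutes {..<length \<pi>}" "permute_list q \<pi> = \<pi>'"
    using mset_eq_permutation by blast
  then show ?thesis using that permutations_of_set_nth(1)[OF assms(1)] by simp
qed

text \<open>
  A position where two permutations agree is fixed by the rearrangement that takes one to the other.
\<close>

lemma rearrangement_eqI:
  assumes \<pi>: "\<pi> \<in> permutations_of_set {1..k}" and q: "q permutes {..<k}"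
    and ab: "a < k" "b < k" "permute_list q \<pi> ! a = \<pi> ! b"
  shows "q a = b"
proof -
  note nth = permutations_of_set_nth[OF \<pi>]
  have "q a < k" using permutes_in_image[OF q, of a] ab by simp
  then show ?thesis using ab q nth(1,3) by (simp add: permute_list_nth)
qed

lemma exists_occurrence_after_block_perm:
  assumes \<pi>: "\<pi> \<in> permutations_of_set {1..k}" and "inj x"
  shows "\<exists>q. q permutes {..<k} \<and> occurs_at \<pi> (x \<circ> block_perm q k s) s"
proof -
  let ?xs = "map x [s..<s + k]"
  have dist: "distinct ?xs"
    using \<open>inj x\<close> by (auto simp: distinct_map intro: inj_on_subset)
  then have st: "st ?xs \<in> permutations_of_set {1..k}"
    using st_permutation by fastforce
  then obtain q where q: "q permutes {..<k}" "permute_list q (st ?xs) = \<pi>"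
    using exists_rearrangement \<pi> by blast
  have "occurs_at (st ?xs) x s"
    using dist permutations_of_set_nth(1)[OF st] by (simp add: occurs_at_def)
  then show ?thesis using occurs_at_block_perm[OF st q(1)] q by auto
qed

section \<open>Framed patterns and their overlaps\<close>

text \<open>
  The feature shared by \<open>\<sigma>\<close> and \<open>\<tau>\<close>, which alone governs how their occurrences can overlap: the
  minimum comes first, the third largest value comes last but one, and so the two largest values
  occupy the second and the last position, in either order.
\<close>

definition framed :: "nat \<Rightarrow> nat list \<Rightarrow> bool" where
  "framed k \<pi> \<longleftrightarrow> \<pi> \<in> permutations_of_set {1..k} \<and> \<pi> ! 0 = 1 \<and> \<pi> ! (k - 2) = k - 2 \<and>
     k - 2 < \<pi> ! 1 \<and> k - 2 < \<pi> ! (k - 1)"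

text \<open>
  The trace that a framed pattern leaves in a real sequence. It forgets the order of the interior
  entries and of the two largest ones, so that it survives the rearrangements used below.
\<close>

definition frame_at :: "nat \<Rightarrow> (nat \<Rightarrow> real) \<Rightarrow> nat \<Rightarrow> bool" where
  "frame_at k x s \<longleftrightarrow>
     (\<forall>a. 0 < a \<and> a < k \<longrightarrow> x s < x (s + a)) \<and>
     (\<forall>a<k. a \<notin> {1, k - 2, k - 1} \<longrightarrow> x (s + a) < x (s + (k - 2))) \<and>
     x (s + (k - 2)) < x (s + 1) \<and> x (s + (k - 2)) < x (s + (k - 1))"

lemma framed_nth_less:
  assumes "framed k \<pi>" "4 \<le> k" "a < k" "a \<notin> {1, k - 2, k - 1}"
  shows "\<pi> ! a < k - 2"
proof -
  have \<pi>: "\<pi> \<in> permutations_of_set {1..k}" using assms(1) by (simp add: framed_def)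
  note nth = permutations_of_set_nth[OF \<pi>]
  have "\<pi> ! a \<noteq> \<pi> ! 1" "\<pi> ! a \<noteq> \<pi> ! (k - 2)" "\<pi> ! a \<noteq> \<pi> ! (k - 1)" "\<pi> ! 1 \<noteq> \<pi> ! (k - 1)"
    using assms nth(3) by auto
  moreover have "\<pi> ! 1 \<le> k" "\<pi> ! (k - 1) \<le> k" "\<pi> ! a \<le> k"
    using assms nth(2)[of 1] nth(2)[of "k - 1"] nth(2)[of a] by auto
  ultimately show ?thesis using assms(1) unfolding framed_def by linarith
qed

lemma occurs_at_framed:
  assumes "framed k \<pi>" "4 \<le> k" "occurs_at \<pi> x s"
  shows "frame_at k x s"
proof -
  have \<pi>: "\<pi> \<in> permutations_of_set {1..k}" and ends: "\<pi> ! 0 = 1" "\<pi> ! (k - 2) = k - 2"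
      "k - 2 < \<pi> ! 1" "k - 2 < \<pi> ! (k - 1)"
    using assms(1) by (simp_all add: framed_def)
  note nth = permutations_of_set_nth[OF \<pi>]
  have iso: "\<pi> ! a < \<pi> ! b \<longleftrightarrow> x (s + a) < x (s + b)" if "a < k" "b < k" for a b
    using assms(3) that unfolding occurs_at_iff_order_iso[OF \<pi>] by blast
  have "x s < x (s + a)" if "0 < a" "a < k" for a
  proof -
    have "\<pi> ! a \<noteq> 1" "1 \<le> \<pi> ! a" using nth(3)[of a 0] nth(2)[of a] that ends by auto
    then show ?thesis using iso[of 0 a] that ends(1) by simp
  qed
  moreover have "x (s + a) < x (s + (k - 2))" if "a < k" "a \<notin> {1, k - 2, k - 1}" for a
    using framed_nth_less[OF assms(1,2) that] iso[of a "k - 2"] that ends(2) assms(2) by simp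
  moreover have "x (s + (k - 2)) < x (s + 1)" "x (s + (k - 2)) < x (s + (k - 1))"
    using iso[of "k - 2" 1] iso[of "k - 2" "k - 1"] ends assms(2) by simp_all
  ultimately show ?thesis unfolding frame_at_def by blast
qed

lemma frame_atD:
  assumes "frame_at k x s"
  shows "0 < a \<Longrightarrow> a < k \<Longrightarrow> x s < x (s + a)"
    and "a < k \<Longrightarrow> a \<notin> {1, k - 2, k - 1} \<Longrightarrow> x (s + a) < x (s + (k - 2))"
    and "x (s + (k - 2)) < x (s + 1)" "x (s + (k - 2)) < x (s + (k - 1))"
  using assms unfolding frame_at_def by blast+

text \<open>
  Overlapping frames share at most two positions. If the second frame starts \<open>d\<close> positions after the
  first and \<open>1 < d < k - 2\<close>, then the second entry of the later frame exceeds every interior entry of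
  that frame, among them the last entry of the earlier frame; but it sits in the interior of the
  earlier frame or is its last entry but one, hence is smaller than that last entry. If \<open>d = 1\<close>, the
  later frame would start with its minimum at a position whose value exceeds the last entry but one of
  the earlier frame.
\<close>

lemma frame_at_overlap:
  assumes "frame_at k x s" "frame_at k x t" "s < t" "4 \<le> k"
  shows "s + (k - 2) \<le> t"
proof (rule ccontr)
  assume "\<not> ?thesis"
  then obtain d where t: "t = s + d" and d: "0 < d" "d < k - 2"
    using \<open>s < t\<close> by (metis less_imp_add_positive not_le nat_add_left_cancel_less)
  show False
  proof (cases "d = 1")
    case True
    have "x t < x (t + (k - 3))" by (rule frame_atD(1)[OF assms(2)]) (use assms(4) in simp_all)
    moreover have "t + (k - 3) = s + (k - 2)" using t True assms(4) by simp
    moreover have "x (s + (k - 2)) < x t" using frame_atD(3)[OF assms(1)] t True by simp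
    ultimately show False by (metis less_asym)
  next
    case False
    let ?a = "k - 1 - d"
    have "x (t + ?a) < x (t + (k - 2))"
      by (rule frame_atD(2)[OF assms(2)]) (use d False in auto)
    also have "\<dots> < x (t + 1)" by (rule frame_atD(3)[OF assms(2)])
    also have "x (t + 1) = x (s + (d + 1))" using t by (simp add: add.assoc)
    also have "\<dots> \<le> x (s + (k - 2))"
    proof (cases "d + 1 = k - 2")
      case False
      have "x (s + (d + 1)) < x (s + (k - 2))"
        by (rule frame_atD(2)[OF assms(1)]) (use d False in auto)
      then show ?thesis by simp
    qed simp
    also have "\<dots> < x (s + (k - 1))" by (rule frame_atD(4)[OF assms(1)])
    also have "s + (k - 1) = t + ?a" using t d by simp
    finally show False by simp
  qed
qed

lemma occurs_at_cong:
  assumes "\<And>n. s \<le> n \<Longrightarrow> n < s + length \<pi> \<Longrightarrow> x n = y n"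
  shows "occurs_at \<pi> x s \<longleftrightarrow> occurs_at \<pi> y s"
proof -
  have "map x [s..<s + length \<pi>] = map y [s..<s + length \<pi>]" using assms by auto
  then show ?thesis unfolding occurs_at_def by metis
qed

text \<open>
  Rearranging the interior of a frame affects no occurrence elsewhere: one that shares an interior
  position with the frame would overlap it in more than two positions.
\<close>

lemma occurs_at_block_perm_interior:
  assumes \<rho>: "framed k \<rho>" and k: "4 \<le> k" and q: "q permutes {..<k}"
    and ends: "q 0 = 0" "q 1 = 1" "q (k - 2) = k - 2" "q (k - 1) = k - 1"
    and frame: "frame_at k x n" "frame_at k (x \<circ> block_perm q k n) n"
    and "s \<noteq> n"
  shows "occurs_at \<rho> (x \<circ> block_perm q k n) s \<longleftrightarrow> occurs_at \<rho> x s"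
proof (cases "s + (k - 2) \<le> n \<or> n + (k - 2) \<le> s")
  case True
  have len: "length \<rho> = k" using \<rho> permutations_of_set_nth(1) by (auto simp: framed_def)
  have fixed: "block_perm q k n m = m" if m: "s \<le> m" "m < s + k" for m
  proof (cases "n \<le> m \<and> m < n + k")
    case True
    then have "m - n \<in> {0, 1, k - 2, k - 1}"
      using m \<open>s + (k - 2) \<le> n \<or> n + (k - 2) \<le> s\<close> k by auto
    then have "q (m - n) = m - n" using ends by auto
    then show ?thesis using True by (simp add: block_perm_def)
  qed (auto simp: block_perm_def)
  then show ?thesis using len by (intro occurs_at_cong) simp
next
  case False
  have "\<not> occurs_at \<rho> z s" if "frame_at k z n" for z
    using occurs_at_framed[OF \<rho> k, of z s] frame_at_overlap[OF _ that, of s]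
      frame_at_overlap[OF that, of s] False \<open>s \<noteq> n\<close> k by (metis linorder_neqE_nat)
  then show ?thesis using frame by blast
qed

lemma order_iso_extend:
  fixes f :: "nat \<Rightarrow> 'a :: linorder" and g :: "nat \<Rightarrow> 'b :: linorder"
  assumes "\<And>a b. a < k - 1 \<Longrightarrow> b < k - 1 \<Longrightarrow> f a < f b \<longleftrightarrow> g a < g b"
    and "\<And>a. a < k - 1 \<Longrightarrow> f a \<noteq> f (k - 1)" "\<And>a. a < k - 1 \<Longrightarrow> g a \<noteq> g (k - 1)"
    and "\<And>a. a < k - 1 \<Longrightarrow> f a < f (k - 1) \<longleftrightarrow> g a < g (k - 1)"
  shows "\<forall>a<k. \<forall>b<k. f a < f b \<longleftrightarrow> g a < g b"
proof (intro allI impI)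
  fix a b assume "a < k" "b < k"
  then consider "a < k - 1" "b < k - 1" | "a < k - 1" "b = k - 1" | "a = k - 1" "b < k - 1"
    | "a = k - 1" "b = k - 1" by linarith
  then show "f a < f b \<longleftrightarrow> g a < g b"
  proof cases
    case 3
    then show ?thesis using assms(2-4)[of b] by (metis less_asym linorder_neqE)
  qed (use assms in auto)
qed

section \<open>Exchanging the two largest values\<close>

definition top_swapped :: "nat \<Rightarrow> nat list \<Rightarrow> nat list \<Rightarrow> bool" where
  "top_swapped k \<sigma> \<tau> \<longleftrightarrow> \<sigma> ! 1 = k \<and> \<sigma> ! (k - 1) = k - 1 \<and> \<tau> ! 1 = k - 1 \<and> \<tau> ! (k - 1) = k \<and>
     (\<forall>a<k. a \<noteq> 1 \<longrightarrow> a \<noteq> k - 1 \<longrightarrow> \<tau> ! a = \<sigma> ! a)"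

text \<open>
  For two patterns that differ only by exchanging their two largest values, an occurrence of either
  one puts a weak constraint on the last entry of the block: it only has to exceed the entry before
  it. Whether it falls above or below the second entry merely decides which of the two patterns
  occurs; injectivity excludes a tie.
\<close>

lemma occurs_at_either_iff:
  assumes \<sigma>: "framed k \<sigma>" and \<tau>: "framed k \<tau>" and swap: "top_swapped k \<sigma> \<tau>" and k: "4 \<le> k"
    and "inj x"
  shows "occurs_at \<sigma> x s \<or> occurs_at \<tau> x s \<longleftrightarrow>
    x (s + (k - 2)) < x (s + (k - 1)) \<and>
    (\<forall>a<k - 1. \<forall>b<k - 1. \<sigma> ! a < \<sigma> ! b \<longleftrightarrow> x (s + a) < x (s + b))"
    (is "?either \<longleftrightarrow> ?last \<and> ?iso")
proof -
  have perm: "\<sigma> \<in> permutations_of_set {1..k}" "\<tau> \<in> permutations_of_set {1..k}"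
    using \<sigma> \<tau> by (simp_all add: framed_def)
  have top: "\<sigma> ! 1 = k" "\<sigma> ! (k - 1) = k - 1" "\<tau> ! 1 = k - 1" "\<tau> ! (k - 1) = k"
    and other: "\<And>a. a < k \<Longrightarrow> a \<noteq> 1 \<Longrightarrow> a \<noteq> k - 1 \<Longrightarrow> \<tau> ! a = \<sigma> ! a"
    using swap by (auto simp: top_swapped_def)
  have low: "\<sigma> ! a \<le> k - 2" if "a < k - 1" "a \<noteq> 1" for a
  proof (cases "a = k - 2")
    case True
    then show ?thesis using \<sigma> by (simp add: framed_def)
  next
    case False
    moreover have "a < k" "a \<noteq> k - 1" using that by linarith+
    ultimately have "\<sigma> ! a < k - 2" using framed_nth_less[OF \<sigma> k] that by blast
    then show ?thesis by simp
  qed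
  have same: "\<tau> ! a < \<tau> ! b \<longleftrightarrow> \<sigma> ! a < \<sigma> ! b" if "a < k - 1" "b < k - 1" for a b
  proof (cases "a = 1"; cases "b = 1")
    assume "a \<noteq> 1" "b = 1"
    then show ?thesis using that low[of a] other[of a] top k by auto
  next
    assume "a = 1" "b \<noteq> 1"
    then show ?thesis using that low[of b] other[of b] top k by auto
  qed (use that other in auto)
  show ?thesis
  proof
    assume ?either
    then show "?last \<and> ?iso"
    proof
      assume occ: "occurs_at \<sigma> x s"
      have "?last" by (intro frame_atD(4) occurs_at_framed[OF \<sigma> k occ])
      moreover have "?iso" using occ occurs_at_iff_order_iso[OF perm(1), of x s] by auto
      ultimately show ?thesis by blast
    next
      assume occ: "occurs_at \<tau> x s"
      have "?last" by (intro frame_atD(4) occurs_at_framed[OF \<tau> k occ])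
      moreover have "?iso"
        using occ same occurs_at_iff_order_iso[OF perm(2), of x s] by auto
      ultimately show ?thesis by blast
    qed
  next
    assume R: "?last \<and> ?iso"
    then have iso: "\<sigma> ! a < \<sigma> ! b \<longleftrightarrow> x (s + a) < x (s + b)" if "a < k - 1" "b < k - 1" for a b
      using that by blast
    have below: "x (s + a) < x (s + (k - 1))" if "a < k - 1" "a \<noteq> 1" for a
    proof -
      have "\<not> \<sigma> ! (k - 2) < \<sigma> ! a" using low[OF that] \<sigma> by (simp add: framed_def)
      then have "x (s + a) \<le> x (s + (k - 2))" using iso[of "k - 2" a] that k by auto
      then show ?thesis using R by linarith
    qed
    have neq: "x (s + a) \<noteq> x (s + (k - 1))" if "a < k - 1" for a
      using inj_eq[OF \<open>inj x\<close>, of "s + a" "s + (k - 1)"] that by simp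
    show ?either
    proof (cases "x (s + (k - 1)) < x (s + 1)")
      case True
      have "\<sigma> ! a < \<sigma> ! (k - 1) \<longleftrightarrow> x (s + a) < x (s + (k - 1))" if "a < k - 1" for a
      proof (cases "a = 1")
        case False
        then show ?thesis using below[OF that] low[OF that] top k by simp
      next
        case 1: True
        show ?thesis using True top unfolding 1 by simp
      qed
      then have "\<forall>a<k. \<forall>b<k. \<sigma> ! a < \<sigma> ! b \<longleftrightarrow> x (s + a) < x (s + b)"
        using order_iso_extend[of k "(!) \<sigma>" "\<lambda>a. x (s + a)"] iso neq
          permutations_of_set_nth(3)[OF perm(1)] k by simp
      then show ?thesis using occurs_at_iff_order_iso[OF perm(1)] by blast
    next
      case False
      then have "x (s + 1) < x (s + (k - 1))" using neq[of 1] k by force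
      then have above: "x (s + a) < x (s + (k - 1))" if "a < k - 1" for a
        using below[OF that] by (cases "a = 1") auto
      have "\<tau> ! a < \<tau> ! (k - 1)" if "a < k - 1" for a
        using that low[of a] other[of a] top k by (cases "a = 1") auto
      then have "\<forall>a<k. \<forall>b<k. \<tau> ! a < \<tau> ! b \<longleftrightarrow> x (s + a) < x (s + b)"
        using order_iso_extend[of k "(!) \<tau>" "\<lambda>a. x (s + a)"] iso neq above same
          permutations_of_set_nth(3)[OF perm(2)] k by simp
      then show ?thesis using occurs_at_iff_order_iso[OF perm(2)] by blast
    qed
  qed
qed

text \<open>
  Rearranging the block at \<open>i\<close> with its first entry kept in place does not change at which earlier
  positions one of the two patterns occurs. The only delicate position is \<open>i - (k - 2)\<close>, where the last
  two entries of the earlier block are the first two of the block at \<open>i\<close>: the last entry of the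
  earlier block changes, but before and after it exceeds the minimum of the block at \<open>i\<close>, which is all
  that the previous lemma asks of it.
\<close>

lemma occurs_at_either_block_perm:
  assumes \<sigma>: "framed k \<sigma>" and \<tau>: "framed k \<tau>" and swap: "top_swapped k \<sigma> \<tau>" and k: "4 \<le> k"
    and "inj x" and q: "q permutes {..<k}" "q 0 = 0"
    and frame: "frame_at k x i" "frame_at k (x \<circ> block_perm q k i) i"
    and "s < i"
  shows "occurs_at \<sigma> (x \<circ> block_perm q k i) s \<or> occurs_at \<tau> (x \<circ> block_perm q k i) s \<longleftrightarrow>
    occurs_at \<sigma> x s \<or> occurs_at \<tau> x s"
proof -
  let ?y = "x \<circ> block_perm q k i"
  have "inj ?y" using \<open>inj x\<close> inj_comp_block_perm_iff[OF q(1)] by blast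
  have before: "?y n = x n" if "n \<le> i" for n
    using that q(2) by (auto simp: block_perm_def)
  show ?thesis
  proof (cases "s + (k - 2) \<le> i")
    case True
    have "?y (s + a) = x (s + a)" if "a < k - 1" for a
      using that True by (intro before) simp
    moreover have "?y (s + (k - 2)) < ?y (s + (k - 1)) \<longleftrightarrow> x (s + (k - 2)) < x (s + (k - 1))"
    proof (cases "s + (k - 2) = i")
      case True
      have "s + (k - 1) = i + 1" using k True by simp
      have *: "z (s + (k - 2)) < z (s + (k - 1))" if "frame_at k z i" for z
        unfolding \<open>s + (k - 1) = i + 1\<close> True using k that by (intro frame_atD(1)) auto
      show ?thesis using *[OF frame(1)] *[OF frame(2)] by blast
    next
      case False
      then have "s + (k - 2) \<le> i" "s + (k - 1) \<le> i" using True k by auto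
      then show ?thesis using before by metis
    qed
    ultimately show ?thesis
      unfolding occurs_at_either_iff[OF \<sigma> \<tau> swap k \<open>inj x\<close>]
        occurs_at_either_iff[OF \<sigma> \<tau> swap k \<open>inj ?y\<close>] by simp
  next
    case False
    have "\<not> occurs_at \<rho> z s" if "framed k \<rho>" "frame_at k z i" for \<rho> z
      using occurs_at_framed[OF that(1) k, of z s] frame_at_overlap[OF _ that(2) \<open>s < i\<close> k]
        False by blast
    then show ?thesis using frame \<sigma> \<tau> by blast
  qed
qed

lemma occurs_at_unique:
  assumes "\<pi> \<in> permutations_of_set {1..k}" "\<rho> \<in> permutations_of_set {1..k}"
    and "occurs_at \<pi> x s" "occurs_at \<rho> x s"
  shows "\<pi> = \<rho>"
  using assms(3,4) permutations_of_set_nth(1)[OF assms(1)] permutations_of_set_nth(1)[OF assms(2)]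
  unfolding occurs_at_def by metis

lemma framed_last_eq:
  assumes \<pi>: "framed k \<pi>" and \<rho>: "framed k \<rho>" and k: "4 \<le> k" and "\<pi> ! 1 = \<rho> ! 1"
  shows "\<pi> ! (k - 1) = \<rho> ! (k - 1)"
proof -
  have "\<pi> ! 1 \<noteq> \<pi> ! (k - 1) \<and> k - 2 < \<pi> ! 1 \<and> k - 2 < \<pi> ! (k - 1) \<and> \<pi> ! 1 \<le> k \<and> \<pi> ! (k - 1) \<le> k"
    if "framed k \<pi>" for \<pi>
    using permutations_of_set_nth(2)[of \<pi> k 1] permutations_of_set_nth(2)[of \<pi> k "k - 1"]
      permutations_of_set_nth(3)[of \<pi> k 1 "k - 1"] that k by (simp add: framed_def)
  from this[OF \<pi>] this[OF \<rho>] assms(4) show ?thesis by linarith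
qed

lemma exists_top_swapped:
  assumes \<sigma>: "framed k \<sigma>" and k: "4 \<le> k" and top: "\<sigma> ! 1 = k"
  obtains \<tau> where "framed k \<tau>" "top_swapped k \<sigma> \<tau>"
proof -
  have perm: "\<sigma> \<in> permutations_of_set {1..k}" using \<sigma> by (simp add: framed_def)
  note nth = permutations_of_set_nth[OF perm]
  let ?t = "Transposition.transpose 1 (k - 1)"
  let ?\<tau> = "permute_list ?t \<sigma>"
  have t: "?t permutes {..<k}" using k by (intro permutes_swap_id) auto
  have \<tau>_nth: "?\<tau> ! a = \<sigma> ! ?t a" if "a < k" for a
    using that t nth(1) by (simp add: permute_list_nth)
  have last: "\<sigma> ! (k - 1) = k - 1"
  proof -
    have "k - 2 < \<sigma> ! (k - 1)" using \<sigma> by (simp add: framed_def)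
    moreover have "\<sigma> ! (k - 1) \<le> k" using nth(2)[of "k - 1"] k by simp
    moreover have "\<sigma> ! (k - 1) \<noteq> \<sigma> ! 1" using nth(3)[of "k - 1" 1] k by simp
    ultimately show ?thesis using top by linarith
  qed
  have "?\<tau> \<in> permutations_of_set {1..k}"
    using perm t nth(1) by (simp add: permutations_of_set_def)
  then have "framed k ?\<tau>"
    using \<sigma> k top last \<tau>_nth unfolding framed_def by (auto simp: transpose_def)
  moreover have "top_swapped k \<sigma> ?\<tau>"
    using k top last \<tau>_nth unfolding top_swapped_def by (auto simp: transpose_def)
  ultimately show ?thesis using that by blast
qed

section \<open>First occurrences\<close>

text \<open>
  The second forbidden pattern may depend on the position, so that it can be replaced at one position
  at a time.
\<close>

definition first_block ::
  "nat list \<Rightarrow> (nat \<Rightarrow> nat list) \<Rightarrow> nat list \<Rightarrow> nat \<Rightarrow> (nat \<Rightarrow> real) \<Rightarrow> bool" where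
  "first_block \<sigma> \<gamma> \<rho> i x \<longleftrightarrow>
     occurs_at \<rho> x i \<and> (\<forall>s. s < i \<longrightarrow> \<not> occurs_at \<sigma> x s \<and> \<not> occurs_at (\<gamma> s) x s)"

lemma enat_less_first_occurrence_iff:
  "enat i < first_occurrence \<pi> x \<longleftrightarrow> (\<forall>s. s \<le> i \<longrightarrow> \<not> occurs_at \<pi> x s)"
proof -
  have "enat i < first_occurrence \<pi> x \<longleftrightarrow> enat (Suc i) \<le> first_occurrence \<pi> x"
    using Suc_ile_eq by blast
  also have "\<dots> \<longleftrightarrow> (\<forall>s. occurs_at \<pi> x s \<longrightarrow> Suc i \<le> s)"
    by (simp add: first_occurrence_def le_INF_iff)
  finally show ?thesis by (meson not_less_eq_eq)
qed

lemma first_occurrence_less_iff: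
  assumes "\<pi> \<in> permutations_of_set {1..k}" "\<rho> \<in> permutations_of_set {1..k}" "\<pi> \<noteq> \<rho>"
  shows "first_occurrence \<pi> x < first_occurrence \<rho> x \<longleftrightarrow>
    (\<exists>i. occurs_at \<pi> x i \<and> (\<forall>s. s < i \<longrightarrow> \<not> occurs_at \<pi> x s \<and> \<not> occurs_at \<rho> x s))"
    (is "?less \<longleftrightarrow> ?ex")
proof -
  have "?less \<longleftrightarrow> (\<exists>i. occurs_at \<pi> x i \<and> (\<forall>s. s \<le> i \<longrightarrow> \<not> occurs_at \<rho> x s))"
  proof
    assume ?less
    then obtain i where "occurs_at \<pi> x i" "enat i < first_occurrence \<rho> x"
    proof (cases "\<exists>i. occurs_at \<pi> x i")
      case True
      define m where "m = (LEAST i. occurs_at \<pi> x i)"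
      have m: "occurs_at \<pi> x m" using True unfolding m_def by (metis LeastI)
      have "enat m \<le> first_occurrence \<pi> x"
        unfolding first_occurrence_def m_def by (intro INF_greatest) (simp add: Least_le)
      then show ?thesis using m that \<open>?less\<close> by (meson le_less_trans)
    next
      case False
      then show ?thesis using \<open>?less\<close> by (simp add: first_occurrence_def top_enat_def)
    qed
    then show "\<exists>i. occurs_at \<pi> x i \<and> (\<forall>s. s \<le> i \<longrightarrow> \<not> occurs_at \<rho> x s)"
      using enat_less_first_occurrence_iff by blast
  next
    assume "\<exists>i. occurs_at \<pi> x i \<and> (\<forall>s. s \<le> i \<longrightarrow> \<not> occurs_at \<rho> x s)"
    then obtain i where i: "occurs_at \<pi> x i" "enat i < first_occurrence \<rho> x"
      using enat_less_first_occurrence_iff by blast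
    then have "first_occurrence \<pi> x \<le> enat i"
      unfolding first_occurrence_def by (intro INF_lower) simp
    then show ?less using i(2) by (meson le_less_trans)
  qed
  also have "\<dots> \<longleftrightarrow> ?ex"
  proof
    assume ?ex
    then show "\<exists>i. occurs_at \<pi> x i \<and> (\<forall>s. s \<le> i \<longrightarrow> \<not> occurs_at \<rho> x s)"
      using occurs_at_unique[OF assms(1,2)] assms(3) by (metis le_neq_implies_less)
  next
    assume R: "\<exists>i. occurs_at \<pi> x i \<and> (\<forall>s. s \<le> i \<longrightarrow> \<not> occurs_at \<rho> x s)"
    define m where "m = (LEAST i. occurs_at \<pi> x i)"
    have "occurs_at \<pi> x m" "\<forall>s. s < m \<longrightarrow> \<not> occurs_at \<pi> x s"
      using R not_less_Least LeastI_ex[of "occurs_at \<pi> x"] unfolding m_def by blast+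
    moreover have "\<forall>s. s < m \<longrightarrow> \<not> occurs_at \<rho> x s"
      using R calculation by (metis le_trans less_imp_le not_less)
    ultimately show ?ex by blast
  qed
  finally show ?thesis .
qed

lemma first_occurrence_neq:
  assumes "\<pi> \<in> permutations_of_set {1..k}" "\<rho> \<in> permutations_of_set {1..k}" "\<pi> \<noteq> \<rho>"
    and "\<exists>s. occurs_at \<pi> x s"
  shows "first_occurrence \<pi> x \<noteq> first_occurrence \<rho> x"
proof
  assume eq: "first_occurrence \<pi> x = first_occurrence \<rho> x"
  have "enat i < first_occurrence \<pi> x \<longleftrightarrow> enat i < first_occurrence \<rho> x" for i
    using eq by simp
  then have *: "(\<forall>s. s \<le> i \<longrightarrow> \<not> occurs_at \<pi> x s) \<longleftrightarrow> (\<forall>s. s \<le> i \<longrightarrow> \<not> occurs_at \<rho> x s)" for i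
    by (simp add: enat_less_first_occurrence_iff)
  define m where "m = (LEAST i. occurs_at \<pi> x i)"
  have m: "occurs_at \<pi> x m" "\<And>s. s < m \<Longrightarrow> \<not> occurs_at \<pi> x s"
    using assms(4) not_less_Least LeastI_ex[of "occurs_at \<pi> x"] unfolding m_def by blast+
  have "\<not> occurs_at \<rho> x s" if "s < m" for s
    using *[of s] m(2) that by (meson le_less_trans order_refl)
  then have "occurs_at \<rho> x m" using *[of m] m(1) by (metis le_neq_implies_less order_refl)
  then show False using occurs_at_unique[OF assms(1,2) m(1)] assms(3) by blast
qed

section \<open>The law of an i.i.d. sequence with continuous marginals\<close>

locale continuous_iid_law =
  fixes \<mu> :: "real measure"
  assumes prob_space_\<mu>: "prob_space \<mu>"
    and sets_\<mu>: "sets \<mu> = sets borel"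
    and no_atoms: "measure \<mu> {a} = 0"
begin

abbreviation L :: "(nat \<Rightarrow> real) measure" where
  "L \<equiv> Pi\<^sub>M UNIV (\<lambda>_. \<mu>)"

sublocale L: prob_space L
  by (intro prob_space_PiM prob_space_\<mu>)

lemma space_L [simp]: "space L = UNIV"
  using sets_eq_imp_space_eq[OF sets_\<mu>] by (auto simp: space_PiM)

lemma measurable_coordinate:
  "n \<in> I \<Longrightarrow> (\<lambda>x. x n) \<in> borel_measurable (Pi\<^sub>M I (\<lambda>_. \<mu>))"
  using measurable_component_singleton[of n I "\<lambda>_. \<mu>"] measurable_cong_sets[OF refl sets_\<mu>]
  by blast

lemma pred_occurs_at:
  assumes "\<pi> \<in> permutations_of_set {1..k}" "{s..<s + k} \<subseteq> I"
  shows "Measurable.pred (Pi\<^sub>M I (\<lambda>_. \<mu>)) (\<lambda>x. occurs_at \<pi> x s)"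
proof -
  have meas: "Measurable.pred (Pi\<^sub>M I (\<lambda>_. \<mu>)) (\<lambda>x. x (s + a) < x (s + b))" if "a < k" "b < k" for a b
    using that by (intro borel_measurable_pred_less measurable_coordinate subsetD[OF assms(2)]) auto
  have "Measurable.pred (Pi\<^sub>M I (\<lambda>_. \<mu>))
      (\<lambda>x. \<forall>a\<in>{..<k}. \<forall>b\<in>{..<k}. \<pi> ! a < \<pi> ! b \<longleftrightarrow> x (s + a) < x (s + b))"
    by (intro pred_intros_finite(3) pred_intros_logic(6) measurable_const meas) auto
  then show ?thesis unfolding occurs_at_iff_order_iso[OF assms(1)] Ball_def lessThan_iff .
qed

lemma pred_occurs_at_L:
  "\<pi> \<in> permutations_of_set {1..k} \<Longrightarrow> Measurable.pred L (\<lambda>x. occurs_at \<pi> x s)"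
  by (rule pred_occurs_at) auto

lemma pred_inj: "Measurable.pred L inj"
proof -
  have less: "Measurable.pred L (\<lambda>x. x a < x b)" for a b
    by (intro borel_measurable_pred_less measurable_coordinate) auto
  have "Measurable.pred L (\<lambda>x. \<forall>a b. a = b \<or> x a < x b \<or> x b < x a)"
    by (intro pred_intros_countable pred_intros_logic(5) measurable_const less) auto
  moreover have "inj = (\<lambda>x :: nat \<Rightarrow> real. \<forall>a b. a = b \<or> x a < x b \<or> x b < x a)"
    unfolding fun_eq_iff inj_def by (metis less_irrefl linorder_neqE)
  ultimately show ?thesis by (simp only:)
qed

text \<open>
  An i.i.d. sequence has the same law after any injective renaming of its indices. The renamings used
  are rearrangements of one block, shifts, and the selection of two coordinates.
\<close>

lemma distr_reindex: "inj p \<Longrightarrow> distr L L (\<lambda>x. x \<circ> p) = L"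
  using distr_PiM_reindex[of UNIV "\<lambda>_. \<mu>" p UNIV] prob_space_\<mu> by (simp add: comp_def restrict_UNIV)

lemma measurable_reindex: "(\<lambda>x. x \<circ> p) \<in> measurable L L"
  unfolding comp_def by (intro measurable_PiM_single') (auto simp: space_PiM)

lemma prob_reindex:
  assumes "inj p" "Measurable.pred L P"
  shows "L.prob {x. P (x \<circ> p)} = L.prob {x. P x}"
proof -
  have "L.prob {x. P x} = measure (distr L L (\<lambda>x. x \<circ> p)) {x. P x}"
    by (simp only: distr_reindex[OF assms(1)])
  also have "\<dots> = L.prob {x. P (x \<circ> p)}"
    using assms(2) by (subst measure_distr[OF measurable_reindex]) (auto simp: pred_def)
  finally show ?thesis by simp
qed

lemma AE_reindex:
  assumes "inj p" "AE x in L. P x"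
  shows "AE x in L. P (x \<circ> p)"
  by (rule AE_distrD[OF measurable_reindex]) (simp only: distr_reindex[OF assms(1)] assms(2))

lemma AE_inj: "AE x in L. inj x"
proof -
  interpret \<mu>: prob_space \<mu> by (rule prob_space_\<mu>)
  interpret pair_sigma_finite \<mu> \<mu> ..
  have "AE x in L. x a \<noteq> x b" if "a \<noteq> b" for a b
  proof -
    have eq_set: "{y. (fst y :: real) \<noteq> snd y} \<in> sets (\<mu> \<Otimes>\<^sub>M \<mu>)"
    proof -
      have "sets (\<mu> \<Otimes>\<^sub>M \<mu>) = sets (borel \<Otimes>\<^sub>M borel)"
        by (intro sets_pair_measure_cong sets_\<mu>)
      moreover have "{y. (fst y :: real) \<noteq> snd y} \<in> sets (borel \<Otimes>\<^sub>M borel)"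
        unfolding borel_prod by (intro borel_open open_Collect_neq continuous_intros)
      ultimately show ?thesis by simp
    qed
    have "AE y in \<mu>. z \<noteq> y" for z
      using no_atoms[of z] sets_\<mu> by (intro AE_I[of _ _ "{z}"]) (auto simp: \<mu>.emeasure_eq_measure)
    then have "AE y in \<mu> \<Otimes>\<^sub>M \<mu>. fst y \<noteq> snd y"
      using eq_set by (intro AE_pair_measure) (auto simp: space_pair_measure sets_eq_imp_space_eq[OF sets_\<mu>])
    also have "\<mu> \<Otimes>\<^sub>M \<mu> = distr (Pi\<^sub>M UNIV (\<lambda>_. \<mu>)) (\<mu> \<Otimes>\<^sub>M \<mu>) (\<lambda>x. (x True, x False))"
    proof -
      have "case_bool \<mu> \<mu> = (\<lambda>_. \<mu>)" by (simp add: fun_eq_iff split: bool.split)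
      then show ?thesis
        using pair_measure_eq_distr_PiM[of \<mu> \<mu>] \<mu>.sigma_finite_measure_axioms by simp
    qed
    finally have "AE x in Pi\<^sub>M UNIV (\<lambda>_::bool. \<mu>). x True \<noteq> x False"
      by (subst (asm) AE_distr_iff) (use eq_set in \<open>auto simp: space_pair_measure sets_eq_imp_space_eq[OF sets_\<mu>]\<close>)
    also have "Pi\<^sub>M UNIV (\<lambda>_::bool. \<mu>) =
        distr L (Pi\<^sub>M UNIV (\<lambda>_::bool. \<mu>)) (\<lambda>x. \<lambda>n. x (if n then a else b))"
    proof -
      have "inj (\<lambda>n. if n then a else b)" using that by (intro injI) (simp split: if_splits)
      then show ?thesis
        using distr_PiM_reindex[of UNIV "\<lambda>_. \<mu>" "\<lambda>n. if n then a else b" UNIV] prob_space_\<mu>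
        by (simp add: restrict_UNIV)
    qed
    finally have ae: "AE x in distr L (Pi\<^sub>M UNIV (\<lambda>_::bool. \<mu>)) (\<lambda>x n. x (if n then a else b)).
        x True \<noteq> x False" .
    have "(\<lambda>x n. x (if n then a else b)) \<in> measurable L (Pi\<^sub>M UNIV (\<lambda>_::bool. \<mu>))"
      by (intro measurable_PiM_single' measurable_component_singleton) (auto simp: space_PiM)
    from AE_distrD[OF this ae] show ?thesis by simp
  qed
  then have "AE x in L. \<forall>a b. a \<noteq> b \<longrightarrow> x a \<noteq> x b"
    by (simp add: AE_all_countable)
  then show ?thesis by (auto simp: inj_def elim: eventually_mono)
qed

lemma indep_vars_coordinates: "L.indep_vars (\<lambda>_. \<mu>) (\<lambda>n x. x n) UNIV"
proof -
  have "distr L \<mu> (\<lambda>x. x n) = \<mu>" for n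
    using distr_PiM_component[of UNIV "\<lambda>_. \<mu>" n] prob_space_\<mu> by simp
  moreover have "distr L L (\<lambda>x. x) = L" by (rule distr_id)
  ultimately show ?thesis
    by (subst L.indep_vars_iff_distr_eq_PiM) (auto simp: restrict_UNIV)
qed

text \<open>
  Almost every sequence shows \<open>\<pi>\<close> in its first block after one of the finitely many rearrangements of
  that block. All these events have the same probability, which therefore cannot be zero.
\<close>

lemma prob_occurs_at_pos:
  assumes \<pi>: "\<pi> \<in> permutations_of_set {1..k}"
  shows "0 < L.prob {x. occurs_at \<pi> x 0}"
proof (rule ccontr)
  assume "\<not> ?thesis"
  then have "L.prob {x. occurs_at \<pi> x 0} = 0"
    using measure_nonneg[of L] by (metis less_le)
  then have "AE x in L. \<not> occurs_at \<pi> x 0"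
    using pred_occurs_at_L[OF \<pi>, of 0]
    by (intro AE_I[of _ _ "{x. occurs_at \<pi> x 0}"]) (auto simp: L.emeasure_eq_measure pred_def)
  then have "AE x in L. \<not> occurs_at \<pi> (x \<circ> block_perm q k 0) 0" if "q permutes {..<k}" for q
    using that by (intro AE_reindex bij_is_inj bij_block_perm)
  then have "AE x in L. \<forall>q\<in>{q. q permutes {..<k}}. \<not> occurs_at \<pi> (x \<circ> block_perm q k 0) 0"
    by (intro AE_finite_allI finite_permutations) auto
  with AE_inj have "AE x in L. False"
    by eventually_elim (use exists_occurrence_after_block_perm[OF \<pi>] in blast)
  then show False by simp
qed

text \<open>
  Disjoint blocks are independent and each shows \<open>\<pi>\<close> with the same positive probability.
\<close>

lemma AE_occurs_somewhere:
  assumes \<pi>: "\<pi> \<in> permutations_of_set {1..k}"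
  shows "AE x in L. \<exists>s. occurs_at \<pi> x s"
proof -
  let ?q = "L.prob {x. occurs_at \<pi> x 0}"
  let ?never = "{x. \<forall>s. \<not> occurs_at \<pi> x s}"
  let ?K = "\<lambda>m. {m * k..<m * k + k}"
  note meas = pred_occurs_at_L[OF \<pi>]
  have never [measurable]: "?never \<in> sets L"
  proof -
    have "Measurable.pred L (\<lambda>x. \<forall>s. \<not> occurs_at \<pi> x s)"
      by (intro pred_intros_countable pred_intros_logic meas)
    then show ?thesis by (simp add: pred_def)
  qed
  have miss: "L.prob {x. \<not> occurs_at \<pi> x s} = 1 - ?q" for s
  proof -
    have "occurs_at \<pi> (x \<circ> (+) s) 0 = occurs_at \<pi> x s" for x
      unfolding occurs_at_iff_order_iso[OF \<pi>] by simp
    then have "L.prob {x. occurs_at \<pi> x s} = ?q"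
      using prob_reindex[of "(+) s" "\<lambda>x. occurs_at \<pi> x 0"] meas by simp
    moreover have "{x. \<not> occurs_at \<pi> x s} = space L - {x. occurs_at \<pi> x s}" by auto
    moreover have "{x. occurs_at \<pi> x s} \<in> sets L" using meas[of s] by (simp add: pred_def)
    ultimately show ?thesis using L.prob_compl by metis
  qed
  have disj: "disjoint_family_on ?K UNIV"
  proof -
    have "m = n" if "a \<in> ?K m" "a \<in> ?K n" for a m n
    proof -
      have "a div k = m" "a div k = n"
        using that by (auto intro!: div_nat_eqI simp: mult.commute)
      then show ?thesis by simp
    qed
    then show ?thesis unfolding disjoint_family_on_def by blast
  qed
  have indep: "L.indep_vars (\<lambda>m. Pi\<^sub>M (?K m) (\<lambda>_. \<mu>)) (\<lambda>m x. restrict (\<lambda>n. x n) (?K m)) UNIV"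
    by (rule L.indep_vars_restrict[OF indep_vars_coordinates _ disj]) auto
  have bound: "L.prob ?never \<le> (1 - ?q) ^ n" if "0 < n" for n
  proof -
    let ?B = "\<lambda>m. {z \<in> space (Pi\<^sub>M (?K m) (\<lambda>_. \<mu>)). \<not> occurs_at \<pi> z (m * k)}"
    have vimage: "(\<lambda>x. restrict (\<lambda>n. x n) (?K m)) -` ?B m \<inter> space L = {x. \<not> occurs_at \<pi> x (m * k)}" for m
    proof -
      have "occurs_at \<pi> (restrict x (?K m)) (m * k) = occurs_at \<pi> x (m * k)" for x
        using permutations_of_set_nth(1)[OF \<pi>] by (intro occurs_at_cong) auto
      then show ?thesis by (auto simp: space_PiM sets_eq_imp_space_eq[OF sets_\<mu>])
    qed
    \<comment> \<open>It suffices to inspect the disjoint blocks that start at multiples of \<open>k\<close>.\<close>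
    have "L.prob ?never \<le> L.prob (\<Inter>m<n. {x. \<not> occurs_at \<pi> x (m * k)})"
    proof (rule L.finite_measure_mono)
      have "Measurable.pred L (\<lambda>x. \<forall>m\<in>{..<n}. \<not> occurs_at \<pi> x (m * k))"
        by (intro pred_intros_finite pred_intros_logic meas) auto
      moreover have "(\<Inter>m<n. {x. \<not> occurs_at \<pi> x (m * k)}) =
          {x. \<forall>m\<in>{..<n}. \<not> occurs_at \<pi> x (m * k)}" by auto
      ultimately show "(\<Inter>m<n. {x. \<not> occurs_at \<pi> x (m * k)}) \<in> sets L"
        by (simp add: pred_def)
    qed auto
    also have "\<dots> = (\<Prod>m<n. L.prob {x. \<not> occurs_at \<pi> x (m * k)})"
    proof -
      have "?B m \<in> sets (Pi\<^sub>M (?K m) (\<lambda>_. \<mu>))" for m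
        using pred_occurs_at[OF \<pi>, of "m * k" "?K m"] by (auto intro: predE pred_intros_logic)
      then show ?thesis
        using L.indep_varsD[OF indep, of "{..<n}" ?B] that unfolding vimage by (auto simp: lessThan_empty_iff)
    qed
    also have "\<dots> = (1 - ?q) ^ n" by (simp add: miss)
    finally show ?thesis .
  qed
  have "(\<lambda>n. (1 - ?q) ^ n) \<longlonglongrightarrow> 0"
    using prob_occurs_at_pos[OF \<pi>] L.prob_le_1 by (intro LIMSEQ_power_zero) simp
  then have "L.prob ?never \<le> 0"
    by (rule LIMSEQ_le_const) (use bound in \<open>auto intro!: exI[of _ 1]\<close>)
  then have "emeasure L ?never = 0"
    using measure_nonneg[of L ?never] by (simp add: L.emeasure_eq_measure)
  then show ?thesis by (intro AE_I[OF _ _ never]) auto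
qed


section \<open>Symmetry of the first occurrence\<close>

lemma pred_first_block:
  assumes "\<rho> \<in> permutations_of_set {1..k}" "\<sigma> \<in> permutations_of_set {1..k}"
    and "\<And>s. \<gamma> s \<in> permutations_of_set {1..k}"
  shows "Measurable.pred L (first_block \<sigma> \<gamma> \<rho> i)"
  unfolding first_block_def
  by (intro pred_intros_logic(2,3,4) pred_intros_countable measurable_const
      pred_occurs_at_L[OF assms(1)] pred_occurs_at_L[OF assms(2)] pred_occurs_at_L[OF assms(3)]) auto

text \<open>
  Replacing the forbidden pattern \<open>\<tau>\<close> at a single position \<open>n\<close> by another arrangement \<open>\<tau>'\<close> of its
  interior does not matter. Write the event as the difference of the event \<open>R\<close>, which imposes nothing
  about \<open>\<tau>\<close> at \<open>n\<close>, and of \<open>R\<close> together with an occurrence of \<open>\<tau>\<close> at \<open>n\<close>. Rearranging the interior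
  of the block at \<open>n\<close> turns the latter into \<open>R\<close> together with an occurrence of \<open>\<tau>'\<close> at \<open>n\<close>, because
  \<open>R\<close> does not notice this rearrangement.
\<close>

lemma prob_first_block_replace_at:
  assumes fr: "framed k \<sigma>" "framed k \<rho>" "framed k \<tau>" "framed k \<tau>'" "\<And>s. framed k (\<gamma> s)"
    and k: "4 \<le> k" and "\<sigma> \<noteq> \<tau>" "\<sigma> \<noteq> \<tau>'" and same: "\<tau>' ! 1 = \<tau> ! 1" and "n < i"
  shows "L.prob {x. first_block \<sigma> (\<gamma>(n := \<tau>)) \<rho> i x} =
    L.prob {x. first_block \<sigma> (\<gamma>(n := \<tau>')) \<rho> i x}"
proof -
  have perm: "\<sigma> \<in> permutations_of_set {1..k}" "\<rho> \<in> permutations_of_set {1..k}"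
    "\<tau> \<in> permutations_of_set {1..k}" "\<tau>' \<in> permutations_of_set {1..k}"
    "\<And>s. \<gamma> s \<in> permutations_of_set {1..k}"
    using fr by (simp_all add: framed_def)
  define R where "R x \<longleftrightarrow> occurs_at \<rho> x i \<and> (\<forall>s. s < i \<longrightarrow> \<not> occurs_at \<sigma> x s) \<and>
    (\<forall>s. s < i \<and> s \<noteq> n \<longrightarrow> \<not> occurs_at (\<gamma> s) x s)" for x
  have pred_R: "Measurable.pred L R"
    unfolding R_def
    by (intro pred_intros_logic(2,3,4) pred_intros_countable measurable_const
        pred_occurs_at_L[OF perm(1)] pred_occurs_at_L[OF perm(2)] pred_occurs_at_L[OF perm(5)]) auto
  have pred_RA: "Measurable.pred L (\<lambda>x. R x \<and> occurs_at \<pi> x n)"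
    if "\<pi> \<in> permutations_of_set {1..k}" for \<pi>
    by (intro pred_intros_logic(3) pred_R pred_occurs_at_L[OF that])
  have split: "L.prob {x. first_block \<sigma> (\<gamma>(n := \<pi>)) \<rho> i x} =
      L.prob {x. R x} - L.prob {x. R x \<and> occurs_at \<pi> x n}"
    if "\<pi> \<in> permutations_of_set {1..k}" for \<pi>
  proof -
    have "{x. first_block \<sigma> (\<gamma>(n := \<pi>)) \<rho> i x} = {x. R x} - {x. R x \<and> occurs_at \<pi> x n}"
      using \<open>n < i\<close> by (auto simp: first_block_def R_def)
    then show ?thesis
      using pred_R pred_RA[OF that] by (simp add: pred_def) (subst L.finite_measure_Diff; auto)
  qed
  obtain q where q: "q permutes {..<k}" and \<tau>': "permute_list q \<tau> = \<tau>'"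
    using exists_rearrangement[OF perm(3,4)] .
  have last: "\<tau>' ! (k - 1) = \<tau> ! (k - 1)"
    using framed_last_eq[OF fr(4,3) k same] .
  have fixed: "q 0 = 0" "q 1 = 1" "q (k - 2) = k - 2" "q (k - 1) = k - 1"
    by (rule rearrangement_eqI[OF perm(3) q]; use k \<tau>' fr(3,4) same last in \<open>simp add: framed_def\<close>)+
  have "R (x \<circ> block_perm q k n) \<and> occurs_at \<tau>' (x \<circ> block_perm q k n) n \<longleftrightarrow> R x \<and> occurs_at \<tau> x n" for x
  proof -
    let ?y = "x \<circ> block_perm q k n"
    have occ: "occurs_at \<tau>' ?y n \<longleftrightarrow> occurs_at \<tau> x n"
      using occurs_at_block_perm[OF perm(3) q, of x n] \<tau>' by simp
    have "R ?y \<longleftrightarrow> R x" if \<tau>_at: "occurs_at \<tau> x n"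
    proof -
      have frame: "frame_at k x n" "frame_at k ?y n"
        using occurs_at_framed[OF fr(3) k] occurs_at_framed[OF fr(4) k] \<tau>_at occ by blast+
      have other: "occurs_at \<pi> ?y s \<longleftrightarrow> occurs_at \<pi> x s" if "framed k \<pi>" "s \<noteq> n" for \<pi> s
        using occurs_at_block_perm_interior[OF that(1) k q fixed frame that(2)] .
      \<comment> \<open>The position \<open>n\<close> itself shows \<open>\<tau>\<close> before and \<open>\<tau>'\<close> after the rearrangement, so never \<open>\<sigma>\<close>.\<close>
      have "\<not> occurs_at \<sigma> x n" "\<not> occurs_at \<sigma> ?y n"
        using occurs_at_unique[OF perm(1,3)] occurs_at_unique[OF perm(1,4)] \<tau>_at occ
          \<open>\<sigma> \<noteq> \<tau>\<close> \<open>\<sigma> \<noteq> \<tau>'\<close> by blast+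
      then have "occurs_at \<sigma> ?y s \<longleftrightarrow> occurs_at \<sigma> x s" for s
        using other[OF fr(1), of s] by (cases "s = n") auto
      then show ?thesis
        using other[OF fr(2), of i] other[OF fr(5)] \<open>n < i\<close> unfolding R_def by blast
    qed
    then show ?thesis using occ by blast
  qed
  then have "L.prob {x. R x \<and> occurs_at \<tau> x n} = L.prob {x. R x \<and> occurs_at \<tau>' x n}"
    using prob_reindex[OF bij_is_inj[OF bij_block_perm[OF q]] pred_RA[OF perm(4)], of n] by simp
  then show ?thesis using split[OF perm(3)] split[OF perm(4)] by simp
qed

lemma prob_first_block_replace:
  assumes fr: "framed k \<sigma>" "framed k \<rho>" "framed k \<tau>" "framed k \<tau>'"
    and k: "4 \<le> k" and neq: "\<sigma> \<noteq> \<tau>" "\<sigma> \<noteq> \<tau>'" and same: "\<tau>' ! 1 = \<tau> ! 1"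
  shows "L.prob {x. first_block \<sigma> (\<lambda>_. \<tau>) \<rho> i x} = L.prob {x. first_block \<sigma> (\<lambda>_. \<tau>') \<rho> i x}"
proof -
  let ?\<gamma> = "\<lambda>m s. if s < m then \<tau>' else \<tau>"
  have "L.prob {x. first_block \<sigma> (\<lambda>_. \<tau>) \<rho> i x} = L.prob {x. first_block \<sigma> (?\<gamma> m) \<rho> i x}"
    if "m \<le> i" for m
    using that
  proof (induction m)
    case (Suc m)
    have "?\<gamma> m = (?\<gamma> m)(m := \<tau>)" "?\<gamma> (Suc m) = (?\<gamma> m)(m := \<tau>')" by auto
    moreover have "framed k (?\<gamma> m s)" for s using fr by simp
    ultimately have "L.prob {x. first_block \<sigma> (?\<gamma> m) \<rho> i x} =
        L.prob {x. first_block \<sigma> (?\<gamma> (Suc m)) \<rho> i x}"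
      using prob_first_block_replace_at[OF fr, of "?\<gamma> m" m i] k neq same Suc.prems
      by (metis (no_types, lifting) Suc_le_lessD)
    then show ?case using Suc by simp
  qed simp
  also have "{x. first_block \<sigma> (?\<gamma> i) \<rho> i x} = {x. first_block \<sigma> (\<lambda>_. \<tau>') \<rho> i x}"
    by (auto simp: first_block_def)
  finally show ?thesis by simp
qed

text \<open>
  When the two forbidden patterns differ only by exchanging their two largest values, a rearrangement
  of the block at \<open>i\<close> exchanges the two ways in which the waiting can end. The final \<open>\<tau>\<close> may have an
  interior different from that of the forbidden \<open>\<tau>'\<close>.
\<close>

lemma prob_first_block_top_swapped:
  assumes fr: "framed k \<sigma>" "framed k \<tau>" "framed k \<tau>'" and k: "4 \<le> k"
    and swap: "top_swapped k \<sigma> \<tau>'" and \<tau>_top: "\<tau> ! 1 = k - 1" "\<tau> ! (k - 1) = k"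
  shows "L.prob {x. first_block \<sigma> (\<lambda>_. \<tau>') \<sigma> i x} = L.prob {x. first_block \<sigma> (\<lambda>_. \<tau>') \<tau> i x}"
proof -
  have perm: "\<sigma> \<in> permutations_of_set {1..k}" "\<tau> \<in> permutations_of_set {1..k}"
    "\<tau>' \<in> permutations_of_set {1..k}"
    using fr by (simp_all add: framed_def)
  obtain q where q: "q permutes {..<k}" and \<tau>: "permute_list q \<sigma> = \<tau>"
    using exists_rearrangement[OF perm(1,2)] .
  have "q 0 = 0"
    by (rule rearrangement_eqI[OF perm(1) q]; use k \<tau> fr(1,2) in \<open>simp add: framed_def\<close>)
  let ?P = "\<lambda>\<pi> x. inj x \<and> first_block \<sigma> (\<lambda>_. \<tau>') \<pi> i x"
  have pred_fb: "Measurable.pred L (first_block \<sigma> (\<lambda>_. \<tau>') \<pi> i)"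
    if "\<pi> \<in> permutations_of_set {1..k}" for \<pi>
    using that perm by (intro pred_first_block)
  have pred_P: "Measurable.pred L (?P \<pi>)" if "\<pi> \<in> permutations_of_set {1..k}" for \<pi>
    by (intro pred_intros_logic(3) pred_inj pred_fb that)
  have AE: "L.prob {x. first_block \<sigma> (\<lambda>_. \<tau>') \<pi> i x} = L.prob {x. ?P \<pi> x}"
    if "\<pi> \<in> permutations_of_set {1..k}" for \<pi>
    using AE_inj pred_fb[OF that] pred_P[OF that]
    by (intro L.finite_measure_eq_AE) (auto simp: pred_def elim: eventually_mono)
  have "?P \<tau> (x \<circ> block_perm q k i) \<longleftrightarrow> ?P \<sigma> x" for x
  proof (cases "inj x \<and> occurs_at \<sigma> x i")
    case True
    let ?y = "x \<circ> block_perm q k i"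
    have \<tau>_at: "occurs_at \<tau> ?y i"
      using True occurs_at_block_perm[OF perm(1) q, of x i] \<tau> by simp
    then have frame: "frame_at k x i" "frame_at k ?y i"
      using True occurs_at_framed[OF fr(1) k] occurs_at_framed[OF fr(2) k] by blast+
    have "occurs_at \<sigma> ?y s \<or> occurs_at \<tau>' ?y s \<longleftrightarrow> occurs_at \<sigma> x s \<or> occurs_at \<tau>' x s" if "s < i" for s
      using occurs_at_either_block_perm[OF fr(1,3) swap k _ q \<open>q 0 = 0\<close> frame that] True by blast
    then show ?thesis
      using True \<tau>_at inj_comp_block_perm_iff[OF q] unfolding first_block_def by blast
  next
    case False
    then show ?thesis
      using occurs_at_block_perm[OF perm(1) q, of x i] \<tau> inj_comp_block_perm_iff[OF q, of x i]
      unfolding first_block_def by auto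
  qed
  then have "L.prob {x. ?P \<sigma> x} = L.prob {x. ?P \<tau> x}"
    using prob_reindex[OF bij_is_inj[OF bij_block_perm[OF q]] pred_P[OF perm(2)], of i] by simp
  then show ?thesis using AE perm by simp
qed

text \<open>
  The pattern \<open>\<tau>'\<close> is \<open>\<sigma>\<close> with its two largest values exchanged: it serves as a stand-in for the
  forbidden \<open>\<tau>\<close>, whose interior may be arranged differently from that of \<open>\<sigma>\<close>.
\<close>

lemma prob_first_block_eq:
  assumes fr: "framed k \<sigma>" "framed k \<tau>" and k: "4 \<le> k"
    and top: "\<sigma> ! 1 = k" "\<tau> ! 1 = k - 1"
  shows "L.prob {x. first_block \<sigma> (\<lambda>_. \<tau>) \<sigma> i x} = L.prob {x. first_block \<sigma> (\<lambda>_. \<tau>) \<tau> i x}"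
proof -
  obtain \<tau>' where \<tau>': "framed k \<tau>'" "top_swapped k \<sigma> \<tau>'"
    using exists_top_swapped[OF fr(1) k top(1)] .
  have "\<tau>' ! 1 = \<tau> ! 1" "\<sigma> \<noteq> \<tau>" "\<sigma> \<noteq> \<tau>'" "\<tau> ! (k - 1) = k"
    using \<tau>' top k framed_last_eq[OF fr(2) \<tau>'(1) k] by (auto simp: top_swapped_def)
  then show ?thesis
    using prob_first_block_replace[OF fr(1) _ fr(2) \<tau>'(1) k, of _ i] fr
      prob_first_block_top_swapped[OF fr \<tau>'(1) k \<tau>'(2) top(2)] by metis
qed

text \<open>
  The two events are disjoint unions over the position of the first occurrence of either pattern, so
  they are equally likely; and almost surely one of them happens.
\<close>

lemma prob_first_occurrence_half:
  assumes fr: "framed k \<sigma>" "framed k \<tau>" and k: "4 \<le> k"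
    and top: "\<sigma> ! 1 = k" "\<tau> ! 1 = k - 1"
  shows "L.prob {x. first_occurrence \<sigma> x < first_occurrence \<tau> x} = 1 / 2" (is "L.prob ?A = _")
    and "L.prob {x. first_occurrence \<tau> x < first_occurrence \<sigma> x} = 1 / 2" (is "L.prob ?B = _")
proof -
  have perm: "\<sigma> \<in> permutations_of_set {1..k}" "\<tau> \<in> permutations_of_set {1..k}"
    using fr by (simp_all add: framed_def)
  have "\<sigma> \<noteq> \<tau>" using top k by auto
  let ?E = "\<lambda>\<rho> i. {x. first_block \<sigma> (\<lambda>_. \<tau>) \<rho> i x}"
  have less: "{x. first_occurrence \<sigma> x < first_occurrence \<tau> x} = (\<Union>i. ?E \<sigma> i)"
    using first_occurrence_less_iff[OF perm \<open>\<sigma> \<noteq> \<tau>\<close>] by (auto simp: first_block_def)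
  have greater: "{x. first_occurrence \<tau> x < first_occurrence \<sigma> x} = (\<Union>i. ?E \<tau> i)"
    using first_occurrence_less_iff[OF perm(2,1)] \<open>\<sigma> \<noteq> \<tau>\<close> by (auto simp: first_block_def)
  have E: "?E \<rho> i \<in> sets L" if "\<rho> \<in> permutations_of_set {1..k}" for \<rho> i
    using pred_first_block[OF that perm(1), of "\<lambda>_. \<tau>" i] perm(2) by (simp add: pred_def)
  have sums: "(\<lambda>i. L.prob (?E \<rho> i)) sums L.prob (\<Union>i. ?E \<rho> i)" if "\<rho> = \<sigma> \<or> \<rho> = \<tau>" for \<rho>
  proof (rule L.finite_measure_UNION)
    show "range (?E \<rho>) \<subseteq> sets L" using E perm that by auto
    have "i = j" if "first_block \<sigma> (\<lambda>_. \<tau>) \<rho> i x" "first_block \<sigma> (\<lambda>_. \<tau>) \<rho> j x" for i j x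
      using that \<open>\<rho> = \<sigma> \<or> \<rho> = \<tau>\<close> unfolding first_block_def by (metis linorder_neqE_nat)
    then show "disjoint_family (?E \<rho>)" by (auto simp: disjoint_family_on_def)
  qed
  have eq: "L.prob ?A = L.prob ?B"
    using sums[of \<sigma>] sums[of \<tau>] prob_first_block_eq[OF assms] unfolding less greater
    by (simp add: sums_unique2)
  have meas: "?A \<in> sets L" "?B \<in> sets L"
    unfolding less greater using E perm by auto
  have "AE x in L. x \<in> ?A \<union> ?B"
    using AE_occurs_somewhere[OF perm(1)]
  proof eventually_elim
    case (elim x)
    then show ?case using first_occurrence_neq[OF perm \<open>\<sigma> \<noteq> \<tau>\<close>] by (auto simp: neq_iff)
  qed
  then have "L.prob (?A \<union> ?B) = 1" using meas by (subst L.prob_eq_1) auto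
  moreover have "L.prob (?A \<union> ?B) = L.prob ?A + L.prob ?B"
    using meas by (intro L.finite_measure_Union) auto
  ultimately show "L.prob ?A = 1 / 2" "L.prob ?B = 1 / 2" using eq by simp_all
qed

end


section \<open>Patterns in i.i.d. sequences\<close>

text \<open>
  Continuity of the distribution function excludes atoms, and independence makes the joint law of the
  sequence a product, so the symmetry of the product law applies.
\<close>

lemma pattern_equiv_framed:
  fixes M :: "'a measure"
  assumes iid: "iid_continuous M X" and fr: "framed k \<sigma>" "framed k \<tau>" and k: "4 \<le> k"
    and top: "\<sigma> ! 1 = k" "\<tau> ! 1 = k - 1"
  shows "pattern_equiv M X \<sigma> \<tau>"
proof -
  interpret prob_space M using iid by (simp add: iid_continuous_def)
  let ?\<mu> = "distr M borel (X 0)"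
  have X: "random_variable borel (X i)" and ident: "distr M borel (X i) = ?\<mu>"
    and cont: "continuous_on UNIV (cdf ?\<mu>)" and indep: "indep_vars (\<lambda>_. borel) X UNIV" for i
    using iid by (auto simp: iid_continuous_def indep_vars_def)
  interpret \<mu>: real_distribution ?\<mu>
    using X by (simp add: real_distribution_def prob_space_distr real_distribution_axioms_def)
  interpret continuous_iid_law ?\<mu>
  proof
    show "measure ?\<mu> {a} = 0" for a
      using \<mu>.isCont_cdf[of a] cont by (simp add: continuous_on_eq_continuous_at)
  qed simp
  have law: "distr M (Pi\<^sub>M UNIV (\<lambda>_. borel)) (\<lambda>\<omega> i. X i \<omega>) = L"
  proof -
    have "(\<lambda>i. distr M borel (X i)) = (\<lambda>_. ?\<mu>)" using ident by (rule ext)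
    moreover have "distr M (Pi\<^sub>M UNIV (\<lambda>_. borel)) (\<lambda>\<omega>. \<lambda>i\<in>UNIV. X i \<omega>) =
        (\<Pi>\<^sub>M i\<in>UNIV. distr M borel (X i))"
      using indep X by (subst indep_vars_iff_distr_eq_PiM[symmetric]) auto
    ultimately show ?thesis by (simp only: restrict_UNIV)
  qed
  have Xmeas: "(\<lambda>\<omega> i. X i \<omega>) \<in> measurable M (Pi\<^sub>M UNIV (\<lambda>_. borel))"
    using X by (intro measurable_PiM_single') (auto simp: space_PiM)
  have transfer: "prob {\<omega> \<in> space M. P (\<lambda>i. X i \<omega>)} = L.prob {x. P x}" if "{x. P x} \<in> sets L" for P
  proof -
    have "{x. P x} \<in> sets (Pi\<^sub>M UNIV (\<lambda>_. borel))"
      using that law by (metis sets_distr)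
    then show ?thesis unfolding law[symmetric]
      by (subst measure_distr[OF Xmeas]) (auto intro!: arg_cong[where f = prob])
  qed
  note half = prob_first_occurrence_half[OF fr k top]
  have "{x. first_occurrence \<sigma> x < first_occurrence \<tau> x} \<in> sets L"
    "{x. first_occurrence \<tau> x < first_occurrence \<sigma> x} \<in> sets L"
    using half measure_notin_sets[of _ L] by force+
  then show ?thesis
    using half transfer[of "\<lambda>x. first_occurrence \<sigma> x < first_occurrence \<tau> x"]
      transfer[of "\<lambda>x. first_occurrence \<tau> x < first_occurrence \<sigma> x"]
    by (simp add: pattern_equiv_def prob_before_def)
qed

theorem theorem3p13:
  fixes M :: "'a measure" and X :: "nat \<Rightarrow> 'a \<Rightarrow> real"
    and k :: nat and \<sigma> \<tau> \<alpha> \<beta> :: "nat list"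
  assumes "iid_continuous M X"
    and "k \<ge> 4"
    and "\<alpha> \<in> permutations_of_set {2..k - 3}"
    and "\<beta> \<in> permutations_of_set {2..k - 3}"
    and "\<sigma> \<in> permutations_of_set {1..k}"
    and "\<tau> \<in> permutations_of_set {1..k}"
    and "\<sigma> = [1, k] @ \<alpha> @ [k - 2, k - 1]"
    and "\<tau> = [1, k - 1] @ \<beta> @ [k - 2, k]"
  shows "pattern_equiv M X \<sigma> \<tau>"
proof -
  have ends: "([1, b] @ \<gamma> @ [c, d]) ! (k - 2) = c" "([1, b] @ \<gamma> @ [c, d]) ! (k - 1) = d"
    if "length ([1, b] @ \<gamma> @ [c, d]) = k" for b c d and \<gamma> :: "nat list"
    using that by (auto simp: nth_append nth_Cons')
  have less: "k - 2 < k - 1" "k - 2 < k" using assms(2) by auto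
  have len: "length \<sigma> = k" "length \<tau> = k"
    using assms(5,6) permutations_of_set_nth(1) by blast+
  have "framed k \<sigma>"
    using ends[of k \<alpha> "k - 2" "k - 1"] assms(5) less len(1) unfolding framed_def assms(7) by auto
  moreover have "framed k \<tau>"
    using ends[of "k - 1" \<beta> "k - 2" k] assms(6) less len(2) unfolding framed_def assms(8) by auto
  ultimately show ?thesis
    using assms(1,2,7,8) by (intro pattern_equiv_framed[where k = k]) auto
qed

end
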